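(* Let $a$ be a nonzero rational number and let $p,q$ be rational numbers with $p^2+q^2\neq 0$. (1) The polynomial $x^4+ax^2+x+1$ is divisible by $x^2+px+q$ if and only if $q\neq 0,\pm1$ and \[a=\frac{q^6-q^4-q^3-q^2+1}{q(q-1)^2(q+1)^2},\qquad p=\frac{-q}{q^2-1}.\] In this case \[x^4+ax^2+x+1=\Big(x^2-\frac{q}{q^2-1}x+q\Big)\Big(x^2+\frac{q}{q^2-1}x+\frac{1}{q}\Big).\] (2) The polynomial $x^4+ax^3+x+1$ is divisible by $x^2+px+q$ if and only if $(a,p,q)=(1,2,1)$ or $(a,p,q)=(1,-1,1)$. In this case $x^4+x^3+x+1=(x^2-x+1)(x+1)^2$. (3) The polynomial $x^4+ax^3+x^2+1$ has no quadratic factor $x^2+px+q$ with $p,q\in\mathbb{Q}$.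
   Context: All polynomials are in $\mathbb{Q}[x]$. A "quadratic factor" means a monic quadratic $x^2+px+q$ with rational coefficients dividing the polynomial in $\mathbb{Q}[x]$. *)

theory Defs
  imports Complex_Main "HOL-Computational_Algebra.Polynomial"
begin

end

theory Submission
  imports Defs "HOL-Computational_Algebra.Nth_Powers"
begin

text \<open>
  Comparing coefficients, the first family is solved by elimination, while a quadratic factor in
  the other two yields a rational point with \<open>q \<noteq> 0\<close> on \<open>y\<^sup>2 = q (4 q\<^sup>2 + q + 4)\<close> (with \<open>y = 2 p - q\<close>)
  and on \<open>p\<^sup>2 = q (q\<^sup>2 - q + 1)\<close>, elliptic curves of conductor 21 and 24.  Both have rank 0 and
  torsion group of order 4, whose only points with \<open>q \<noteq> 0\<close> have \<open>q = 1\<close>.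

  Writing \<open>q\<close> in lowest terms shows that it is a square \<open>r\<^sup>2 / s\<^sup>2\<close>, where \<open>4 r\<^sup>4 + r\<^sup>2 s\<^sup>2 + 4 s\<^sup>4\<close>,
  respectively \<open>r\<^sup>4 - r\<^sup>2 s\<^sup>2 + s\<^sup>4\<close>, is a square \<open>t\<^sup>2\<close>.  If \<open>r\<close> or \<open>s\<close> is even, completing the
  square factors \<open>63 s\<^sup>4\<close>, respectively \<open>3 s\<^sup>4\<close>, and a 2-descent leads to a smaller
  solution of the same kind.  If both are odd, translation by a 4-torsion point turns a solution
  with \<open>r \<noteq> s\<close> into one in which exactly one of the two is even.
\<close>

section \<open>Coprime factors of powers, residues of squares and Pythagorean triples\<close>

lemma coprime_mult_eq_powerE:
  fixes a b c :: int
  assumes "coprime a b" "a > 0" "b > 0" "c > 0" "n > 0" "a * b = c ^ n"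
  obtains x y where "x > 0" "y > 0" "a = x ^ n" "b = y ^ n" "c = x * y"
proof -
  have "nat a * nat b = nat c ^ n"
    using assms by (simp flip: nat_mult_distrib nat_power_eq)
  then have "is_nth_power n (nat a * nat b)"
    by simp
  moreover have "coprime (nat a) (nat b)"
    using assms by (simp flip: coprime_int_iff)
  ultimately obtain x y where xy: "nat a = x ^ n" "nat b = y ^ n"
    using is_nth_power_mult_coprime_natD[of "nat a" "nat b" n] assms
    by (auto simp: is_nth_power_def)
  have ab: "a = int x ^ n" "b = int y ^ n"
    using xy assms by (metis int_nat_eq less_imp_le of_nat_power)+
  have pos: "int x > 0" "int y > 0"
    using ab assms by (auto intro!: gr0I simp: zero_power)
  have "c ^ n = (int x * int y) ^ n"
    using ab assms(6) by (simp add: power_mult_distrib)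
  then have "c = int x * int y"
    using assms(4,5) by (intro power_eq_imp_eq_base[of c n]) auto
  with ab pos that show thesis
    by blast
qed

text \<open>After division by \<open>g = gcd a b\<close> the cofactors are coprime with square
  product, hence squares. As \<open>g\<close> divides \<open>2 ^ 4\<close>, it is a square (1, 4,
  16) or twice a square (2, 8), which decides between the two outcomes.\<close>

lemma mult_eq_square_cases:
  fixes a b c :: int
  assumes "a > 0" "b > 0" "c > 0" "a * b = c\<^sup>2" "gcd a b dvd 16"
  obtains x y where "x > 0" "y > 0" "a = x\<^sup>2" "b = y\<^sup>2" "c = x * y"
  | x y where "x > 0" "y > 0" "a = 2 * x\<^sup>2" "b = 2 * y\<^sup>2"
proof -
  define g where "g = gcd a b"
  have g: "g > 0"
    using assms by (simp add: g_def)
  obtain a' b' where ab: "a = a' * g" "b = b' * g" "coprime a' b'"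
    using gcd_coprime_exists[of a b] g unfolding g_def by auto
  have "c\<^sup>2 = g\<^sup>2 * (a' * b')"
    using assms(4) ab by (simp add: power2_eq_square ac_simps)
  then have "g dvd c"
    by (metis dvd_triv_left pos2 pow_divides_pow_iff)
  then obtain c' where c': "c = g * c'" ..
  have "a' * b' = c'\<^sup>2"
    using \<open>c\<^sup>2 = _\<close> c' g by (simp add: power_mult_distrib)
  moreover have "a' > 0" "b' > 0" "c' > 0"
    using ab c' assms g by (simp_all add: zero_less_mult_iff)
  ultimately obtain x y where xy: "x > 0" "y > 0" "a' = x\<^sup>2" "b' = y\<^sup>2" "c' = x * y"
    using coprime_mult_eq_powerE[of a' b' c' 2] ab by auto
  have "g dvd 2 ^ 4"
    using assms(5) by (simp add: g_def)
  then obtain i where "i \<le> 4" "g = 2 ^ i"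
    using divides_primepow[of "2::int" g 4] g by auto
  then have "g \<in> {1, 2, 4, 8, 16}"
    by (auto simp: le_Suc_eq eval_nat_numeral)
  then have "(\<exists>h>0. g = h\<^sup>2) \<or> (\<exists>h>0. g = 2 * h\<^sup>2)"
  proof (elim insertE emptyE)
    assume "g = 1" then show ?thesis by (intro disjI1 exI[of _ 1]) simp
  next
    assume "g = 2" then show ?thesis by (intro disjI2 exI[of _ 1]) simp
  next
    assume "g = 4" then show ?thesis by (intro disjI1 exI[of _ 2]) simp
  next
    assume "g = 8" then show ?thesis by (intro disjI2 exI[of _ 2]) simp
  next
    assume "g = 16" then show ?thesis by (intro disjI1 exI[of _ 4]) simp
  qed
  then show thesis
  proof (elim disjE exE conjE)
    fix h assume "0 < h" "g = h\<^sup>2"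
    with xy ab c' show thesis
      by (intro that(1)[of "x * h" "y * h"]) (auto simp: power2_eq_square)
  next
    fix h assume "0 < h" "g = 2 * h\<^sup>2"
    with xy ab show thesis
      by (intro that(2)[of "x * h" "y * h"]) (auto simp: power2_eq_square)
  qed
qed

lemma coprime_if_no_common_prime:
  fixes a b :: int
  assumes "a \<noteq> 0" "\<And>p. prime p \<Longrightarrow> p dvd a \<Longrightarrow> p dvd b \<Longrightarrow> False"
  shows "coprime a b"
proof (rule ccontr)
  assume "\<not> coprime a b"
  then have "\<not> is_unit (gcd a b)"
    by (simp add: coprime_iff_gcd_eq_1)
  moreover have "gcd a b \<noteq> 0"
    using assms(1) by simp
  ultimately obtain p where "prime p" "p dvd gcd a b"
    using prime_divisor_exists by blast
  with assms(2) show False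
    by auto
qed

text \<open>Serves to bound a gcd: elimination yields two multiples \<open>k * x\<close> and
  \<open>k * y\<close> of it with \<open>x\<close>, \<open>y\<close> coprime.\<close>

lemma dvd_if_dvd_mult_coprime:
  fixes g k x y :: int
  assumes "coprime x y" "g dvd k * x" "g dvd k * y"
  shows "g dvd k"
proof -
  have "g dvd gcd (k * x) (k * y)"
    using assms by simp
  also have "gcd (k * x) (k * y) = \<bar>k\<bar>"
    using assms(1) by (simp add: gcd_mult_distrib_int[symmetric] coprime_iff_gcd_eq_1)
  finally show ?thesis
    by simp
qed

lemma odd_square_mod_8:
  fixes x :: int
  assumes "odd x"
  obtains u where "x\<^sup>2 = 8 * u + 1"
proof -
  obtain k where k: "x = 2 * k + 1"
    using assms oddE by blast
  have "even (k * (k + 1))"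
    by simp
  then obtain u where "k * (k + 1) = 2 * u"
    by blast
  then have "x\<^sup>2 = 8 * u + 1"
    unfolding k by (simp add: power2_eq_square algebra_simps)
  with that show thesis .
qed

text \<open>2 is not a square modulo 3. In the descents this rules out that both factors are twice a
  square.\<close>

lemma three_dvd_if_square_eq_twice_square:
  fixes x y z :: int
  assumes "x\<^sup>2 + 3 * z = 2 * y\<^sup>2"
  shows "3 dvd x" "3 dvd y"
proof -
  have m: "w\<^sup>2 mod 3 = (if 3 dvd w then 0 else 1)" for w :: int
  proof -
    define c where "c = w mod 3"
    have "w\<^sup>2 mod 3 = c\<^sup>2 mod 3" "3 dvd w \<longleftrightarrow> c = 0"
      by (simp_all add: c_def power_mod dvd_eq_mod_eq_0)
    moreover have "c = 0 \<or> c = 1 \<or> c = 2"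
      unfolding c_def by presburger
    ultimately show ?thesis
      by auto
  qed
  from assms have "x\<^sup>2 mod 3 = (2 * (y\<^sup>2 mod 3)) mod 3"
    by presburger
  then show "3 dvd x" "3 dvd y"
    by (auto simp: m split: if_splits)
qed

text \<open>The halves of \<open>b + a\<close> and \<open>b - a\<close> are coprime with product
  \<open>(d / 2)^2\<close>, so they are squares \<open>m^2\<close> and \<open>n^2\<close>.\<close>

lemma odd_pythagoreanE:
  fixes a b d :: int
  assumes "odd a" "odd b" "coprime a b" "a > 0" "b > 0" "d > 0" "b\<^sup>2 - a\<^sup>2 = d\<^sup>2"
  obtains m n where "m > 0" "n > 0" "coprime m n" "odd (m + n)"
    "b = m\<^sup>2 + n\<^sup>2" "a = m\<^sup>2 - n\<^sup>2" "d = 2 * m * n"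
proof -
  define x y where "x = (b + a) div 2" and "y = (b - a) div 2"
  have ab: "b = x + y" "a = x - y"
    using assms(1,2) unfolding x_def y_def by presburger+
  have "4 * (x * y) = d\<^sup>2"
    using assms(7) unfolding ab by (simp add: power2_eq_square algebra_simps)
  then have "even d"
    by (metis dvd_mult2 even_numeral even_power pos2)
  then obtain e where e: "d = 2 * e"
    by blast
  have xy: "x * y = e\<^sup>2"
    using \<open>4 * (x * y) = d\<^sup>2\<close> e by simp
  have "e > 0"
    using e assms by simp
  then have "x * y > 0"
    by (simp add: xy)
  moreover have "x + y > 0"
    using ab assms by simp
  ultimately have pos: "x > 0" "y > 0"
    by (auto simp: zero_less_mult_iff)
  have "coprime x y"
  proof (rule coprimeI)
    fix c assume "c dvd x" "c dvd y"
    then have "c dvd a" "c dvd b"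
      using ab by simp_all
    with \<open>coprime a b\<close> show "is_unit c"
      by (rule coprime_common_divisor)
  qed
  then obtain m n where mn: "m > 0" "n > 0" "x = m\<^sup>2" "y = n\<^sup>2" "e = m * n"
    using coprime_mult_eq_powerE[of x y e 2] pos \<open>e > 0\<close> xy by auto
  show thesis
  proof (rule that)
    show "coprime m n"
      using \<open>coprime x y\<close> mn by simp
    show "odd (m + n)"
      using \<open>odd b\<close> ab mn by simp
  qed (use mn ab e in auto)
qed

section \<open>Quartic Diophantine equations\<close>

text \<open>Infinite descent on \<open>r\<close>. From
  \<open>4 t^2 = (2 r^2 - s^2)^2 + 3 s^4\<close> arise two coprime odd factors \<open>X\<close>,
  \<open>Y\<close> of \<open>3 s^4\<close>, one a fourth power and the other three times one. Only
  \<open>X = 3 a^4\<close>, \<open>Y = b^4\<close> survives, and it yields a solution in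
  \<open>m\<close>, \<open>n\<close>, \<open>g\<close> with \<open>r = 2 g m n\<close>.\<close>

lemma no_solution_quartic_24_even:
  fixes r s t :: int
  assumes "r > 0" "s > 0" "t > 0" "even r" "odd s" "coprime r s"
    and "r ^ 4 - r\<^sup>2 * s\<^sup>2 + s ^ 4 = t\<^sup>2"
  shows False
  using assms
proof (induction "nat r" arbitrary: r s t rule: less_induct)
  case less
  define X Y where "X = 2 * t - 2 * r\<^sup>2 + s\<^sup>2" and "Y = 2 * t + 2 * r\<^sup>2 - s\<^sup>2"
  have "X * Y = 4 * t\<^sup>2 - (2 * r\<^sup>2 - s\<^sup>2)\<^sup>2"
    unfolding X_def Y_def by algebra
  also have "\<dots> = 3 * s ^ 4"
    unfolding less.prems(7)[symmetric] by algebra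
  finally have XY: "X * Y = 3 * s ^ 4" .
  have "X * Y > 0" "X + Y > 0"
    using less.prems XY by (auto simp: X_def Y_def)
  then have pos: "X > 0" "Y > 0"
    by (auto simp: zero_less_mult_iff)
  have "odd X" "odd Y"
    using less.prems by (simp_all add: X_def Y_def)
  have cop: "coprime X Y"
  proof (rule coprime_if_no_common_prime)
    fix p :: int
    assume p: "prime p" "p dvd X" "p dvd Y"
    have "odd p"
      using p(2) \<open>odd X\<close> dvd_trans by blast
    have "p\<^sup>2 dvd 3 * s ^ 4"
      using p XY by (metis mult_dvd_mono power2_eq_square)
    \<comment> \<open>\<open>p^2\<close> divides \<open>3 s^4\<close> and 3 is squarefree, so
      \<open>p\<close> divides \<open>s\<close>; then \<open>Y - X = 4 r^2 - 2 s^2\<close> forces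
      \<open>p\<close> to divide \<open>r\<close> as well.\<close>
    have "p dvd s"
    proof (rule ccontr)
      assume "\<not> p dvd s"
      then have "coprime (p\<^sup>2) (s ^ 4)"
        using p(1) prime_imp_coprime by auto
      with \<open>p\<^sup>2 dvd 3 * s ^ 4\<close> have "p\<^sup>2 dvd 3"
        by (simp add: coprime_dvd_mult_left_iff)
      then have "p\<^sup>2 \<le> 3"
        by (simp add: zdvd_imp_le)
      moreover have "p\<^sup>2 \<ge> 2\<^sup>2"
        using prime_ge_2_int[OF p(1)] by (intro power_mono) auto
      ultimately show False
        by simp
    qed
    have "p dvd 4 * r\<^sup>2 - 2 * s\<^sup>2"
      using dvd_diff[OF p(3,2)] by (simp add: X_def Y_def algebra_simps)
    moreover have "p dvd 2 * s\<^sup>2"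
      using \<open>p dvd s\<close> by (simp add: power2_eq_square)
    ultimately have "p dvd 4 * r\<^sup>2"
      by (simp add: dvd_diff_left_iff)
    then have "p dvd 2 ^ 2 * r\<^sup>2"
      by simp
    then have "p dvd r"
      using p(1) \<open>odd p\<close> by (metis prime_dvd_mult_iff prime_dvd_power primes_dvd_imp_eq two_is_prime_nat
          even_numeral prime_int_numeral_eq dvd_refl)
    with \<open>p dvd s\<close> \<open>coprime r s\<close> p(1) show False
      using coprime_common_divisor not_prime_unit by blast
  qed (use pos in auto)
  have "3 dvd X * Y"
    by (simp add: XY)
  then have "3 dvd X \<or> 3 dvd Y"
    using prime_dvd_mult_iff[of "3::int"] by simp
  then show False
  proof
    assume "3 dvd Y"
    then obtain Y' where Y': "Y = 3 * Y'" ..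
    have "coprime X Y'" "X * Y' = s ^ 4" "Y' > 0"
      using Y' cop XY pos by auto
    then obtain a b where ab: "a > 0" "b > 0" "X = a ^ 4" "Y' = b ^ 4" "s = a * b"
      using coprime_mult_eq_powerE[of X Y' s 4] pos less.prems(2) by auto
    have "odd a" "odd b"
      using less.prems(5) ab by auto
    then obtain u v where uv: "a\<^sup>2 = 8 * u + 1" "b\<^sup>2 = 8 * v + 1"
      by (metis odd_square_mod_8)
    \<comment> \<open>Contradiction modulo 16: \<open>a^4 - 3 b^4\<close> is -2, while
      \<open>2 a^2 b^2 - 4 r^2\<close> is 2 because \<open>r\<close> is even.\<close>
    obtain k where k: "r = 2 * k"
      using less.prems(4) by blast
    have "X - Y = 2 * s\<^sup>2 - 4 * r\<^sup>2"
      by (simp add: X_def Y_def)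
    then have "(a\<^sup>2)\<^sup>2 - 3 * (b\<^sup>2)\<^sup>2 = 2 * (a\<^sup>2 * b\<^sup>2) - 4 * r\<^sup>2"
      using ab Y' by (simp add: power_mult_distrib)
    then have "16 * (4 * u\<^sup>2 + u - 12 * v\<^sup>2 - 3 * v - 8 * u * v - u - v + k\<^sup>2) = 4"
      unfolding uv k by (simp add: power2_eq_square algebra_simps)
    then have "16 dvd (4::int)"
      by (metis dvd_triv_left)
    then show False
      by simp
  next
    assume "3 dvd X"
    then obtain X' where X': "X = 3 * X'" ..
    have "coprime X' Y" "X' * Y = s ^ 4" "X' > 0"
      using X' cop XY pos by auto
    then obtain a b where ab: "a > 0" "b > 0" "X' = a ^ 4" "Y = b ^ 4" "s = a * b"
      using coprime_mult_eq_powerE[of X' Y s 4] pos less.prems(2) by auto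
    have odd: "odd a" "odd b"
      using less.prems(5) ab by auto
    have "coprime a b"
      using \<open>coprime X' Y\<close> ab by simp
    have "X - Y = 2 * s\<^sup>2 - 4 * r\<^sup>2"
      by (simp add: X_def Y_def)
    then have eq: "(3 * a\<^sup>2 + b\<^sup>2) * (b\<^sup>2 - a\<^sup>2) = (2 * r)\<^sup>2"
      using ab X' by (simp add: power_mult_distrib) algebra
    have A: "3 * a\<^sup>2 + b\<^sup>2 > 0"
      using ab by (simp add: add_pos_pos)
    have "(3 * a\<^sup>2 + b\<^sup>2) * (b\<^sup>2 - a\<^sup>2) > 0"
      unfolding eq using less.prems by simp
    then have B: "b\<^sup>2 - a\<^sup>2 > 0"
      using A by (simp add: zero_less_mult_iff)
    let ?g = "gcd (3 * a\<^sup>2 + b\<^sup>2) (b\<^sup>2 - a\<^sup>2)"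
    have "?g dvd (3 * a\<^sup>2 + b\<^sup>2) - (b\<^sup>2 - a\<^sup>2)" "?g dvd (3 * a\<^sup>2 + b\<^sup>2) + 3 * (b\<^sup>2 - a\<^sup>2)"
      by (meson dvd_add dvd_diff dvd_mult gcd_dvd1 gcd_dvd2)+
    then have dvd: "?g dvd 4 * a\<^sup>2" "?g dvd 4 * b\<^sup>2"
      by simp_all
    have "coprime (a\<^sup>2) (b\<^sup>2)"
      using \<open>coprime a b\<close> by simp
    then have "?g dvd 4"
      using dvd by (rule dvd_if_dvd_mult_coprime)
    then have g: "?g dvd 16"
      by (rule dvd_trans) simp
    show False
    proof (rule mult_eq_square_cases[OF A B _ eq g])
      show "2 * r > 0" using less.prems by simp
    next
      fix c d assume cd: "3 * a\<^sup>2 + b\<^sup>2 = 2 * c\<^sup>2"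
      then have "b\<^sup>2 + 3 * a\<^sup>2 = 2 * c\<^sup>2"
        by simp
      note three_dvd_if_square_eq_twice_square[OF this]
      then obtain b' c' where "b = 3 * b'" "c = 3 * c'"
        by blast
      then have "a\<^sup>2 = 3 * (2 * c'\<^sup>2 - b'\<^sup>2)"
        using cd by (simp add: power_mult_distrib)
      then have "3 dvd a\<^sup>2"
        by simp
      then have "3 dvd a"
        using prime_dvd_power[of "3::int" a 2] by simp
      with \<open>3 dvd b\<close> \<open>coprime a b\<close> have "is_unit (3::int)"
        using coprime_common_divisor by blast
      then show False
        by simp
    next
      fix c d assume cd: "c > 0" "d > 0" "3 * a\<^sup>2 + b\<^sup>2 = c\<^sup>2" "b\<^sup>2 - a\<^sup>2 = d\<^sup>2" "2 * r = c * d"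
      obtain m n where mn: "m > 0" "n > 0" "coprime m n" "odd (m + n)"
          "b = m\<^sup>2 + n\<^sup>2" "a = m\<^sup>2 - n\<^sup>2" "d = 2 * m * n"
        using odd_pythagoreanE[OF odd \<open>coprime a b\<close> ab(1,2) cd(2,4)] by blast
      \<comment> \<open>The parametrization turns \<open>3 a^2 + b^2\<close> into four times the
        original quartic, now in \<open>m\<close> and \<open>n\<close>.\<close>
      have c2: "c\<^sup>2 = 4 * (m ^ 4 - m\<^sup>2 * n\<^sup>2 + n ^ 4)"
        unfolding cd(3)[symmetric] mn by algebra
      then have "even c"
        by (metis dvd_mult2 even_numeral even_power pos2)
      then obtain g where g: "c = 2 * g"
        by blast
      have g2: "m ^ 4 - m\<^sup>2 * n\<^sup>2 + n ^ 4 = g\<^sup>2"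
        using c2 g by simp
      have "g > 0"
        using g cd by simp
      have r: "r = m * (2 * g * n)" "r = n * (2 * g * m)"
        using cd(5) g mn by simp_all
      have "g * n > 0" "g * m > 0"
        using mn \<open>g > 0\<close> by simp_all
      then have "2 * g * n > 1" "2 * g * m > 1"
        by simp_all
      then have lt: "m < r" "n < r"
        using r mn(1,2) by (metis mult.right_neutral mult_less_cancel_left_pos)+
      show False
      \<comment> \<open>The quartic is symmetric, so whichever of \<open>m\<close> and
        \<open>n\<close> is even takes the place of \<open>r\<close>.\<close>
      proof (cases "even m")
        case True
        then show False
          using less.hyps[of m n g] lt mn \<open>g > 0\<close> g2 by auto
      next
        case False
        then show False
          using less.hyps[of n m g] lt mn \<open>g > 0\<close> g2
          by (auto simp: coprime_commute algebra_simps)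
      qed
    qed
  qed
qed

section \<open>Descent for \<open>4 r^4 + r^2 s^2 + 4 s^4 = t^2\<close>\<close>

text \<open>Stated for a general \<open>R\<close> because it is applied with \<open>r\<close> and
  with \<open>3 * r\<close>. The gcd of the two factors divides 16; if both are twice squares, 3
  divides \<open>a\<close> and \<open>b\<close>, and otherwise the Pythagorean parametrization turns
  \<open>9 b^2 + 7 a^2\<close> into four times the quartic in \<open>m\<close>,
  \<open>n\<close>.\<close>

lemma descent_step_21:
  fixes a b R :: int
  assumes "odd a" "odd b" "coprime a b" "a > 0" "b > 0" "R > 0"
    and eq: "(9 * b\<^sup>2 + 7 * a\<^sup>2) * (b\<^sup>2 - a\<^sup>2) = (4 * R)\<^sup>2"
  obtains m n g where "m > 0" "n > 0" "g > 0" "coprime m n" "odd (m + n)"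
    "4 * m ^ 4 + m\<^sup>2 * n\<^sup>2 + 4 * n ^ 4 = g\<^sup>2" "R = g * m * n"
proof -
  have A: "9 * b\<^sup>2 + 7 * a\<^sup>2 > 0"
    using assms by (simp add: add_pos_pos)
  have "(9 * b\<^sup>2 + 7 * a\<^sup>2) * (b\<^sup>2 - a\<^sup>2) > 0"
    unfolding eq using assms by simp
  then have B: "b\<^sup>2 - a\<^sup>2 > 0"
    using A by (simp add: zero_less_mult_iff)
  let ?g = "gcd (9 * b\<^sup>2 + 7 * a\<^sup>2) (b\<^sup>2 - a\<^sup>2)"
  have "?g dvd (9 * b\<^sup>2 + 7 * a\<^sup>2) - 9 * (b\<^sup>2 - a\<^sup>2)"
       "?g dvd (9 * b\<^sup>2 + 7 * a\<^sup>2) + 7 * (b\<^sup>2 - a\<^sup>2)"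
    by (meson dvd_add dvd_diff dvd_mult gcd_dvd1 gcd_dvd2)+
  then have dvd: "?g dvd 16 * a\<^sup>2" "?g dvd 16 * b\<^sup>2"
    by simp_all
  have "coprime (a\<^sup>2) (b\<^sup>2)"
    using \<open>coprime a b\<close> by simp
  then have g: "?g dvd 16"
    using dvd by (rule dvd_if_dvd_mult_coprime)
  show thesis
  proof (rule mult_eq_square_cases[OF A B _ eq g])
    show "4 * R > 0" using assms by simp
  next
    fix c d assume cd: "9 * b\<^sup>2 + 7 * a\<^sup>2 = 2 * c\<^sup>2" "b\<^sup>2 - a\<^sup>2 = 2 * d\<^sup>2"
    \<comment> \<open>The first equation reads \<open>a^2 + 3 (3 b^2 + 2 a^2) = 2 c^2\<close>; once
      3 divides \<open>a\<close>, the second has the same shape with \<open>b\<close>.\<close>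
    have "3 dvd a"
      using three_dvd_if_square_eq_twice_square[of a "3 * b\<^sup>2 + 2 * a\<^sup>2" c] cd by simp
    then obtain a' where a': "a = 3 * a'" ..
    have "3 dvd b"
      using three_dvd_if_square_eq_twice_square[of b "- 3 * a'\<^sup>2" d] cd
      by (simp add: a' power_mult_distrib)
    with \<open>3 dvd a\<close> \<open>coprime a b\<close> have "is_unit (3::int)"
      using coprime_common_divisor by blast
    then show thesis
      by simp
  next
    fix c d
    assume cd: "c > 0" "d > 0" "9 * b\<^sup>2 + 7 * a\<^sup>2 = c\<^sup>2" "b\<^sup>2 - a\<^sup>2 = d\<^sup>2" "4 * R = c * d"
    obtain m n where mn: "m > 0" "n > 0" "coprime m n" "odd (m + n)"
        "b = m\<^sup>2 + n\<^sup>2" "a = m\<^sup>2 - n\<^sup>2" "d = 2 * m * n"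
      using odd_pythagoreanE[OF assms(1-5) cd(2,4)] by blast
    have c2: "c\<^sup>2 = 4 * (4 * m ^ 4 + m\<^sup>2 * n\<^sup>2 + 4 * n ^ 4)"
      unfolding cd(3)[symmetric] mn by algebra
    then have "even c"
      by (metis dvd_mult2 even_numeral even_power)
    then obtain g where g: "c = 2 * g"
      by blast
    show thesis
    proof (rule that)
      show "4 * m ^ 4 + m\<^sup>2 * n\<^sup>2 + 4 * n ^ 4 = g\<^sup>2"
        using c2 g by simp
    qed (use g cd mn in simp_all)
  qed
qed

text \<open>Infinite descent on \<open>r\<close> from
  \<open>16 t^2 = (8 r^2 + s^2)^2 + 63 s^4\<close>. The factors \<open>X\<close>, \<open>Y\<close>
  of \<open>63 s^4\<close> are fourth powers up to divisors of 63. Congruences exclude every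
  distribution of 63 except \<open>X = 63 a^4\<close>, \<open>Y = b^4\<close> and
  \<open>X = 7 a^4\<close>, \<open>Y = 9 b^4\<close>, which feed the descent.\<close>

lemma no_solution_quartic_21_even:
  fixes r s t :: int
  assumes "r > 0" "s > 0" "t > 0" "even r" "odd s" "coprime r s"
    and "4 * r ^ 4 + r\<^sup>2 * s\<^sup>2 + 4 * s ^ 4 = t\<^sup>2"
  shows False
  using assms
proof (induction "nat r" arbitrary: r s t rule: less_induct)
  case less
  define X Y where "X = 4 * t - 8 * r\<^sup>2 - s\<^sup>2" and "Y = 4 * t + 8 * r\<^sup>2 + s\<^sup>2"
  have "X * Y = 16 * t\<^sup>2 - (8 * r\<^sup>2 + s\<^sup>2)\<^sup>2"
    unfolding X_def Y_def by algebra
  also have "\<dots> = 63 * s ^ 4"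
    unfolding less.prems(7)[symmetric] by algebra
  finally have XY: "X * Y = 63 * s ^ 4" .
  have diff: "Y - X = 16 * r\<^sup>2 + 2 * s\<^sup>2"
    by (simp add: X_def Y_def)
  have "X * Y > 0" "X + Y > 0"
    using less.prems XY by (auto simp: X_def Y_def)
  then have pos: "X > 0" "Y > 0"
    by (auto simp: zero_less_mult_iff)
  have "odd X" "odd Y"
    using less.prems by (simp_all add: X_def Y_def)
  obtain k where k: "r = 2 * k"
    using less.prems(4) by blast
  have square_dvd: "p\<^sup>2 dvd 63" if p: "prime p" "p dvd X" "p dvd Y" for p
  proof -
    have "odd p"
      using p(2) \<open>odd X\<close> dvd_trans by blast
    have "\<not> p dvd s"
    proof
      assume "p dvd s"
      have "p dvd 16 * r\<^sup>2 + 2 * s\<^sup>2"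
        using dvd_diff[OF p(3,2)] by (simp add: diff)
      moreover have "p dvd 2 * s\<^sup>2"
        using \<open>p dvd s\<close> by (simp add: power2_eq_square)
      ultimately have "p dvd 16 * r\<^sup>2"
        by (simp add: dvd_add_left_iff)
      then have "p dvd 2 ^ 4 * r\<^sup>2"
        by simp
      then have "p dvd r"
        using p(1) \<open>odd p\<close> by (metis prime_dvd_mult_iff prime_dvd_power primes_dvd_imp_eq
            two_is_prime_nat even_numeral prime_int_numeral_eq dvd_refl)
      with \<open>p dvd s\<close> \<open>coprime r s\<close> p(1) show False
        using coprime_common_divisor not_prime_unit by blast
    qed
    then have "coprime (p\<^sup>2) (s ^ 4)"
      using p(1) prime_imp_coprime by auto
    moreover have "p\<^sup>2 dvd 63 * s ^ 4"
      using p XY by (metis mult_dvd_mono power2_eq_square)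
    ultimately show ?thesis
      by (simp add: coprime_dvd_mult_left_iff)
  qed
  \<comment> \<open>Since \<open>63 = 3^2 * 7\<close>, only 3 can be a common prime.\<close>
  have eq_3: "p = 3" if p: "prime p" "p dvd X" "p dvd Y" for p :: int
  proof -
    have "p\<^sup>2 \<le> 63"
      using square_dvd[OF p] by (simp add: zdvd_imp_le)
    then have "p < 8"
      using power_mono[of 8 p 2] by (cases "p < 8") auto
    then have "p \<in> {2, 3, 4, 5, 6, 7}"
      using prime_ge_2_int[OF p(1)] by auto
    then show ?thesis
      using square_dvd[OF p] by auto
  qed
  have split: thesis if UV: "coprime U V" "U > 0" "V > 0" "U * V = s ^ 4"
    and *: "\<And>a b u v. a > 0 \<Longrightarrow> b > 0 \<Longrightarrow> odd a \<Longrightarrow> odd b \<Longrightarrow> coprime a b \<Longrightarrow> U = a ^ 4 \<Longrightarrow> V = b ^ 4 \<Longrightarrow>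
       s = a * b \<Longrightarrow> a\<^sup>2 = 8 * u + 1 \<Longrightarrow> b\<^sup>2 = 8 * v + 1 \<Longrightarrow> thesis" for U V thesis
  proof -
    obtain a b where ab: "a > 0" "b > 0" "U = a ^ 4" "V = b ^ 4" "s = a * b"
      using coprime_mult_eq_powerE[of U V s 4] UV less.prems(2) by auto
    have "odd a" "odd b"
      using less.prems(5) ab by auto
    then obtain u v where "a\<^sup>2 = 8 * u + 1" "b\<^sup>2 = 8 * v + 1"
      by (metis odd_square_mod_8)
    moreover have "coprime a b"
      using \<open>coprime U V\<close> ab by simp
    ultimately show thesis
      using * ab \<open>odd a\<close> \<open>odd b\<close> by blast
  qed
  have descent: False
    if *: "odd a" "odd b" "coprime a b" "a > 0" "b > 0" "R > 0" "R \<le> 3 * r"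
      "(9 * b\<^sup>2 + 7 * a\<^sup>2) * (b\<^sup>2 - a\<^sup>2) = (4 * R)\<^sup>2" for a b R :: int
  proof -
    obtain m n g where mn: "m > 0" "n > 0" "g > 0" "coprime m n" "odd (m + n)"
      "4 * m ^ 4 + m\<^sup>2 * n\<^sup>2 + 4 * n ^ 4 = g\<^sup>2" "R = g * m * n"
      using descent_step_21[OF *(1-6,8)] by blast
    \<comment> \<open>Opposite parity excludes \<open>m = n = 1\<close>, so \<open>g > 3\<close>.
      Then \<open>4 m n <= g m n = R <= 3 r\<close> absorbs the possible factor 3 and leaves
      \<open>m n < r\<close>.\<close>
    have "m \<ge> 2 \<or> n \<ge> 2"
      using mn by (cases "m = 1 \<and> n = 1") auto
    then have "m ^ 4 \<ge> 16 \<or> n ^ 4 \<ge> 16"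
      using power_mono[of 2 m 4] power_mono[of 2 n 4] by auto
    moreover have "m ^ 4 > 0" "n ^ 4 > 0" "m\<^sup>2 * n\<^sup>2 > 0"
      using mn by simp_all
    ultimately have "g\<^sup>2 > 9"
      unfolding mn(6)[symmetric] by (elim disjE; linarith)
    then have "g > 3"
      using mn(3) power_less_imp_less_base[of 3 2 g] by simp
    have "m * n \<ge> m" "m * n \<ge> n"
      using mn by simp_all
    moreover have "4 * (m * n) \<le> g * (m * n)"
      using \<open>g > 3\<close> mn by (intro mult_right_mono) auto
    moreover have "g * (m * n) \<le> 3 * r"
      using *(7) mn(7) by (simp add: mult.assoc)
    ultimately have lt: "m < r" "n < r"
      using mn(1,2) by linarith+
    show False
    proof (cases "even m")
      case True
      then show False
        using less.hyps[of m n g] lt mn by auto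
    next
      case False
      then show False
        using less.hyps[of n m g] lt mn by (auto simp: coprime_commute algebra_simps)
    qed
  qed
  have seven: "7 dvd U \<or> 7 dvd V" if "7 dvd U * V" for U V :: int
    using that prime_dvd_mult_iff[of "7::int" U V] by simp
  show False
  proof (cases "3 dvd X \<and> 3 dvd Y")
    case True
    then obtain X' Y' where X'Y': "X = 3 * X'" "Y = 3 * Y'"
      by blast
    have XY': "X' * Y' = 7 * s ^ 4"
      using XY X'Y' by simp
    have pos': "X' > 0" "Y' > 0"
      using X'Y' pos by auto
    \<comment> \<open>A common prime could only be 3; then 3 would divide \<open>s\<close> and,
      through \<open>Y - X\<close>, also \<open>r\<close>.\<close>
    have cop: "coprime X' Y'"
    proof (rule coprime_if_no_common_prime)
      fix p :: int
      assume p: "prime p" "p dvd X'" "p dvd Y'"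
      then have "p = 3"
        using eq_3[of p] X'Y' by simp
      then have "3 * 3 dvd X' * Y'"
        using p by (intro mult_dvd_mono) auto
      then have "3 dvd 7 * s ^ 4"
        unfolding XY' by (metis dvd_mult_left)
      then have "3 dvd s"
        using prime_dvd_mult_iff[of "3::int" 7 "s ^ 4"] prime_dvd_power[of "3::int" s 4] by simp
      then have "3 dvd 2 * s\<^sup>2"
        by (simp add: power2_eq_square)
      moreover have "3 dvd 16 * r\<^sup>2 + 2 * s\<^sup>2"
        using True diff by (metis dvd_diff)
      ultimately have "3 dvd 16 * r\<^sup>2"
        by (simp add: dvd_add_left_iff)
      then have "3 dvd r"
        using prime_dvd_mult_iff[of "3::int" 16 "r\<^sup>2"] prime_dvd_power[of "3::int" r 2] by simp
      with \<open>3 dvd s\<close> \<open>coprime r s\<close> have "is_unit (3::int)"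
        using coprime_common_divisor by blast
      then show False
        by simp
    qed (use pos' in auto)
    from seven[of X' Y'] XY' consider "7 dvd X'" | "7 dvd Y'"
      by auto
    then show False
    proof cases
      case 1
      then obtain U where U: "X' = 7 * U" ..
      have "coprime U Y'" "U > 0" "Y' > 0" "U * Y' = s ^ 4"
        using U cop XY' pos' by auto
      then show False
      proof (rule split)
        \<comment> \<open>Modulo 16 the left side is \<open>3 - 21\<close>, that is -2, and the
          right side is 2.\<close>
        fix a b u v
        assume ab: "U = a ^ 4" "Y' = b ^ 4" "s = a * b" and uv: "a\<^sup>2 = 8 * u + 1" "b\<^sup>2 = 8 * v + 1"
        have "3 * (b\<^sup>2)\<^sup>2 - 21 * (a\<^sup>2)\<^sup>2 = 16 * r\<^sup>2 + 2 * (a\<^sup>2 * b\<^sup>2)"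
          using diff ab U X'Y' by (simp add: power_mult_distrib)
        then have "16 * (12 * v\<^sup>2 + 3 * v - 84 * u\<^sup>2 - 21 * u - r\<^sup>2 - 8 * u * v - u - v) = 20"
          unfolding uv by (simp add: power2_eq_square algebra_simps)
        then have "16 dvd (20::int)"
          by (metis dvd_triv_left)
        then show False
          by simp
      qed
    next
      case 2
      then obtain V where V: "Y' = 7 * V" ..
      have "coprime X' V" "X' > 0" "V > 0" "X' * V = s ^ 4"
        using V cop XY' pos' by auto
      then show False
      proof (rule split)
        \<comment> \<open>Both sides agree modulo 16, so the modulus is raised to 64: with
          \<open>r = 2 * k\<close>, the coefficients of \<open>u\<close> and \<open>v\<close> in the
          difference are multiples of 64 and the constant 16 remains.\<close>
        fix a b u v
        assume ab: "X' = a ^ 4" "V = b ^ 4" "s = a * b" and uv: "a\<^sup>2 = 8 * u + 1" "b\<^sup>2 = 8 * v + 1"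
        have "21 * (b\<^sup>2)\<^sup>2 - 3 * (a\<^sup>2)\<^sup>2 = 16 * r\<^sup>2 + 2 * (a\<^sup>2 * b\<^sup>2)"
          using diff ab V X'Y' by (simp add: power_mult_distrib)
        then have "64 * (k\<^sup>2 - 21 * v\<^sup>2 + 3 * u\<^sup>2 + 2 * u * v - 5 * v + u) = 16"
          unfolding uv k by (simp add: power2_eq_square algebra_simps)
        then have "64 dvd (16::int)"
          by (metis dvd_triv_left)
        then show False
          by simp
      qed
    qed
  next
    case False
    have cop: "coprime X Y"
      using False eq_3 pos by (intro coprime_if_no_common_prime) auto
    \<comment> \<open>3 divides at most one factor, so all of \<open>3^2\<close> lies in it. That
      \<open>Y\<close> is prime to 3 in the first alternative is kept for the coprimality of
      \<open>3 * a\<close> and \<open>b\<close>.\<close>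
    have nine: "(9 dvd X \<and> \<not> 3 dvd Y) \<or> 9 dvd Y"
    proof (cases "3 dvd Y")
      case True
      then have "coprime (3\<^sup>2) X"
        using False prime_imp_coprime[of "3::int" X] by (simp only: coprime_power_left_iff) simp
      moreover have "3\<^sup>2 dvd X * Y"
        unfolding XY by simp
      ultimately show ?thesis
        by (simp add: coprime_dvd_mult_right_iff)
    next
      case nY: False
      then have "coprime (3\<^sup>2) Y"
        using prime_imp_coprime[of "3::int" Y] by (simp only: coprime_power_left_iff) simp
      moreover have "3\<^sup>2 dvd X * Y"
        unfolding XY by simp
      ultimately show ?thesis
        using nY by (simp add: coprime_dvd_mult_left_iff)
    qed
    have "7 dvd X \<or> 7 dvd Y"
      by (rule seven) (simp add: XY)
    with nine consider "9 dvd X" "7 dvd X" "\<not> 3 dvd Y" | "9 dvd X" "7 dvd Y"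
      | "9 dvd Y" "7 dvd X" | "9 dvd Y" "7 dvd Y"
      by blast
    then show False
    proof cases
      case 1
      then have "63 dvd X"
        by presburger
      then obtain U where U: "X = 63 * U" ..
      have "coprime U Y" "U > 0" "Y > 0" "U * Y = s ^ 4"
        using U cop XY pos by auto
      then show False
      proof (rule split)
        fix a b
        assume ab: "U = a ^ 4" "Y = b ^ 4" "s = a * b" "a > 0" "b > 0" "odd a" "odd b" "coprime a b"
        have "\<not> 3 dvd b"
          using 1(3) ab(2) by (auto simp: eval_nat_numeral)
        then have "coprime 3 b"
          using prime_imp_coprime[of "3::int" b] by simp
        \<comment> \<open>Multiplication by 9 and the substitution of \<open>3 * a\<close> for
          \<open>a\<close> give the shape of the descent step, at the price of
          \<open>R = 3 * r\<close>.\<close>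
        have "b ^ 4 - 63 * a ^ 4 = 16 * r\<^sup>2 + 2 * (a\<^sup>2 * b\<^sup>2)"
          using diff ab U by (simp add: power_mult_distrib)
        then have "(9 * b\<^sup>2 + 7 * (3 * a)\<^sup>2) * (b\<^sup>2 - (3 * a)\<^sup>2) = (4 * (3 * r))\<^sup>2"
          by algebra
        then show False
          using descent[of "3 * a" b "3 * r"] ab \<open>coprime 3 b\<close> less.prems(1) by simp
      qed
    next
      case 2
      then obtain U V where UV: "X = 9 * U" "Y = 7 * V"
        by blast
      have "coprime U V" "U > 0" "V > 0" "U * V = s ^ 4"
        using UV cop XY pos by auto
      then show False
      proof (rule split)
        \<comment> \<open>Modulo 16 the two sides are \<open>7 - 9 = -2\<close> and 2.\<close>
        fix a b u v
        assume ab: "U = a ^ 4" "V = b ^ 4" "s = a * b" and uv: "a\<^sup>2 = 8 * u + 1" "b\<^sup>2 = 8 * v + 1"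
        have "7 * (b\<^sup>2)\<^sup>2 - 9 * (a\<^sup>2)\<^sup>2 = 16 * r\<^sup>2 + 2 * (a\<^sup>2 * b\<^sup>2)"
          using diff ab UV by (simp add: power_mult_distrib)
        then have "16 * (28 * v\<^sup>2 + 7 * v - 36 * u\<^sup>2 - 9 * u - r\<^sup>2 - 8 * u * v - u - v) = 4"
          unfolding uv by (simp add: power2_eq_square algebra_simps)
        then have "16 dvd (4::int)"
          by (metis dvd_triv_left)
        then show False
          by simp
      qed
    next
      case 3
      then obtain U V where UV: "X = 7 * U" "Y = 9 * V"
        by blast
      have "coprime U V" "U > 0" "V > 0" "U * V = s ^ 4"
        using UV cop XY pos by auto
      then show False
      proof (rule split)
        fix a b
        assume ab: "U = a ^ 4" "V = b ^ 4" "s = a * b" "a > 0" "b > 0" "odd a" "odd b" "coprime a b"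
        have "9 * b ^ 4 - 7 * a ^ 4 = 16 * r\<^sup>2 + 2 * (a\<^sup>2 * b\<^sup>2)"
          using diff ab UV by (simp add: power_mult_distrib)
        then have "(9 * b\<^sup>2 + 7 * a\<^sup>2) * (b\<^sup>2 - a\<^sup>2) = (4 * r)\<^sup>2"
          by algebra
        then show False
          using descent[of a b r] ab less.prems(1) by simp
      qed
    next
      case 4
      then have "63 dvd Y"
        by presburger
      then obtain V where V: "Y = 63 * V" ..
      have "coprime X V" "X > 0" "V > 0" "X * V = s ^ 4"
        using V cop XY pos by auto
      then show False
      proof (rule split)
        \<comment> \<open>Modulo 16 the two sides are \<open>63 - 1\<close>, that is -2, and
          2.\<close>
        fix a b u v
        assume ab: "X = a ^ 4" "V = b ^ 4" "s = a * b" and uv: "a\<^sup>2 = 8 * u + 1" "b\<^sup>2 = 8 * v + 1"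
        have "63 * (b\<^sup>2)\<^sup>2 - (a\<^sup>2)\<^sup>2 = 16 * r\<^sup>2 + 2 * (a\<^sup>2 * b\<^sup>2)"
          using diff ab V by (simp add: power_mult_distrib)
        then have "16 * (r\<^sup>2 - 252 * v\<^sup>2 - 63 * v + 4 * u\<^sup>2 + u + 8 * u * v + u + v) = 60"
          unfolding uv by (simp add: power2_eq_square algebra_simps)
        then have "16 dvd (60::int)"
          by (metis dvd_triv_left)
        then show False
          by simp
      qed
    qed
  qed
qed

section \<open>Solutions with both entries odd\<close>

lemma gcd_reduce_quartic:
  fixes r s t A B :: int
  assumes "r \<noteq> 0" "even r" "odd s" "A * r ^ 4 + B * (r\<^sup>2 * s\<^sup>2) + A * s ^ 4 = t\<^sup>2"
  obtains m n w where "m > 0" "n > 0" "w \<ge> 0" "even m" "odd n" "coprime m n"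
    "A * m ^ 4 + B * (m\<^sup>2 * n\<^sup>2) + A * n ^ 4 = w\<^sup>2"
proof -
  define g where "g = gcd r s"
  have "s \<noteq> 0"
    using assms(3) by auto
  have "g \<noteq> 0"
    using assms(1) by (simp add: g_def)
  then obtain r' s' where rs: "r = r' * g" "s = s' * g" "coprime r' s'"
    using gcd_coprime_exists[of r s] unfolding g_def by auto
  have t: "t\<^sup>2 = (g\<^sup>2)\<^sup>2 * (A * r' ^ 4 + B * (r'\<^sup>2 * s'\<^sup>2) + A * s' ^ 4)"
    unfolding assms(4)[symmetric] rs by algebra
  then have "g\<^sup>2 dvd t"
    by (metis dvd_triv_left pos2 pow_divides_pow_iff)
  then obtain w where w: "t = g\<^sup>2 * w" ..
  have "(g\<^sup>2)\<^sup>2 * w\<^sup>2 = (g\<^sup>2)\<^sup>2 * (A * r' ^ 4 + B * (r'\<^sup>2 * s'\<^sup>2) + A * s' ^ 4)"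
    using t unfolding w by (simp add: power_mult_distrib)
  then have "A * r' ^ 4 + B * (r'\<^sup>2 * s'\<^sup>2) + A * s' ^ 4 = w\<^sup>2"
    using \<open>g \<noteq> 0\<close> by simp
  moreover have "odd s'" "odd g"
    using assms(3) rs by auto
  moreover have "even r'"
    using assms(2) rs \<open>odd g\<close> by simp
  ultimately show thesis
    using rs assms(1) \<open>s \<noteq> 0\<close> by (intro that[of "\<bar>r'\<bar>" "\<bar>s'\<bar>" "\<bar>w\<bar>"]) auto
qed

text \<open>The candidates \<open>(t - c) / 2\<close> and \<open>(- t - c) / 2\<close> differ by the
  odd number \<open>t\<close>, so one of them is odd.\<close>

lemma odd_sign_choice:
  fixes t c :: int
  assumes "odd t" "odd c"
  obtains M where "odd M" "(2 * M + c)\<^sup>2 = t\<^sup>2"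
proof -
  have "odd ((t - c) div 2) \<or> odd ((- t - c) div 2)"
    using assms by presburger
  then show thesis
  proof
    assume "odd ((t - c) div 2)"
    moreover have "2 * ((t - c) div 2) + c = t"
      using assms by presburger
    ultimately show thesis
      using that by metis
  next
    assume "odd ((- t - c) div 2)"
    moreover have "2 * ((- t - c) div 2) + c = - t"
      using assms by presburger
    ultimately show thesis
      using that by (metis power2_minus)
  qed
qed

lemma quartic_24_trivial:
  fixes r s t :: int
  assumes "r > 0" "s > 0" "coprime r s" "r ^ 4 - r\<^sup>2 * s\<^sup>2 + s ^ 4 = t\<^sup>2"
  shows "r = s"
proof (rule ccontr)
  assume "r \<noteq> s"
  have even: False if eq: "x \<noteq> 0" "even x" "odd y" "x ^ 4 - x\<^sup>2 * y\<^sup>2 + y ^ 4 = z\<^sup>2" for x y z :: int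
  proof -
    obtain m n w :: int where mn: "m > 0" "n > 0" "w \<ge> 0" "even m" "odd n" "coprime m n"
      "m ^ 4 - m\<^sup>2 * n\<^sup>2 + n ^ 4 = w\<^sup>2"
      using gcd_reduce_quartic[of x y 1 "- 1" z] eq by auto
    have "odd (w\<^sup>2)"
      unfolding mn(7)[symmetric] using mn(4,5) by simp
    then have "w \<noteq> 0"
      by auto
    then show False
      using no_solution_quartic_24_even[of m n w] mn by simp
  qed
  have "\<not> even r" "\<not> even s"
    using even[of r s t] even[of s r t] assms
    by (auto simp: algebra_simps dest: coprime_common_divisor)
  then have odd: "odd r" "odd s"
    by simp_all
  have "odd (t\<^sup>2)"
    unfolding assms(4)[symmetric] using odd by simp
  then have "odd t"
    by simp
  moreover have "odd (r * s)"
    using odd by simp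
  ultimately obtain M where M: "odd M" "(2 * M + r * s)\<^sup>2 = t\<^sup>2"
    by (rule odd_sign_choice)
  obtain u v where uv: "r\<^sup>2 = 8 * u + 1" "s\<^sup>2 = 8 * v + 1"
    using odd by (metis odd_square_mod_8)
  \<comment> \<open>Translation by the 4-torsion point \<open>(1, 1)\<close> sends \<open>r / s\<close> to \<open>(t - r s) / (r\<^sup>2 - s\<^sup>2) = M / N\<close>, up to
    signs; the sign of \<open>t\<close> was chosen to make \<open>M\<close> odd.\<close>
  define N h where "N = 4 * (u - v)" and "h = 4 * (u + v) + 1"
  have N: "2 * N = r\<^sup>2 - s\<^sup>2" and h: "2 * h = r\<^sup>2 + s\<^sup>2"
    by (simp_all add: N_def h_def uv)
  \<comment> \<open>This is \<open>(r^2 - s^2)^2 = t^2 - (r s)^2\<close> with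
    \<open>t^2 = (2 M + r s)^2\<close>.\<close>
  have "(2 * N)\<^sup>2 = 4 * M\<^sup>2 + 4 * (M * (r * s))"
    using M(2) assms(4) unfolding N by algebra
  then have "N\<^sup>2 = M\<^sup>2 + M * (r * s)"
    by (simp add: power_mult_distrib)
  moreover have "(2 * h)\<^sup>2 = (2 * N)\<^sup>2 + 4 * (r * s)\<^sup>2"
    unfolding N h by algebra
  then have "h\<^sup>2 = N\<^sup>2 + (r * s)\<^sup>2"
    by (simp add: power_mult_distrib)
  \<comment> \<open>\<open>M r s = N^2 - M^2\<close> eliminates \<open>r s\<close> from
    \<open>M^2 h^2 = M^2 N^2 + (M r s)^2\<close>.\<close>
  ultimately have "N ^ 4 - N\<^sup>2 * M\<^sup>2 + M ^ 4 = (M * h)\<^sup>2"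
    by algebra
  moreover have "N \<noteq> 0"
    using N \<open>r \<noteq> s\<close> assms(1,2) by (auto simp: power2_eq_iff)
  moreover have "even N"
    by (simp add: N_def)
  ultimately show False
    using even M(1) by blast
qed

lemma quartic_21_trivial:
  fixes r s t :: int
  assumes "r > 0" "s > 0" "coprime r s" "4 * r ^ 4 + r\<^sup>2 * s\<^sup>2 + 4 * s ^ 4 = t\<^sup>2"
  shows "r = s"
proof (rule ccontr)
  assume "r \<noteq> s"
  have even: False
    if eq: "x \<noteq> 0" "even x" "odd y" "4 * x ^ 4 + x\<^sup>2 * y\<^sup>2 + 4 * y ^ 4 = z\<^sup>2" for x y z :: int
  proof -
    obtain m n w :: int where mn: "m > 0" "n > 0" "w \<ge> 0" "even m" "odd n" "coprime m n"
      "4 * m ^ 4 + m\<^sup>2 * n\<^sup>2 + 4 * n ^ 4 = w\<^sup>2"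
      using gcd_reduce_quartic[of x y 4 1 z] eq by auto
    have "w\<^sup>2 > 0"
      unfolding mn(7)[symmetric] using mn(1,2) by (intro add_pos_pos) simp_all
    then have "w \<noteq> 0"
      by auto
    then show False
      using no_solution_quartic_21_even[of m n w] mn by simp
  qed
  have "\<not> even r" "\<not> even s"
    using even[of r s t] even[of s r t] assms
    by (auto simp: algebra_simps dest: coprime_common_divisor)
  then have odd: "odd r" "odd s"
    by simp_all
  have "odd (t\<^sup>2)"
    unfolding assms(4)[symmetric] using odd by simp
  then have "odd t"
    by simp
  moreover have "odd (3 * (r * s))"
    using odd by simp
  ultimately obtain M where M: "odd M" "(2 * M + 3 * (r * s))\<^sup>2 = t\<^sup>2"
    by (rule odd_sign_choice)
  \<comment> \<open>Translation by the 4-torsion point \<open>(1, 3)\<close> sends \<open>r / s\<close> to \<open>(t - 3 r s) / (2 (r\<^sup>2 - s\<^sup>2)) = M / N\<close>,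
    up to signs.\<close>
  define N where "N = r\<^sup>2 - s\<^sup>2"
  \<comment> \<open>Here \<open>4 (r^2 - s^2)^2 = t^2 - 9 (r s)^2\<close>, which explains the shift
    by \<open>3 * (r * s)\<close>.\<close>
  have "4 * N\<^sup>2 = 4 * (M\<^sup>2 + 3 * (M * (r * s)))"
    using M(2) assms(4) unfolding N_def by algebra
  then have "N\<^sup>2 = M\<^sup>2 + 3 * (M * (r * s))"
    by simp
  moreover have "(r\<^sup>2 + s\<^sup>2)\<^sup>2 = N\<^sup>2 + 4 * (r * s)\<^sup>2"
    unfolding N_def by algebra
  \<comment> \<open>\<open>3 M r s = N^2 - M^2\<close> eliminates \<open>r s\<close> from
    \<open>9 M^2 (r^2 + s^2)^2 = 9 M^2 N^2 + 4 (3 M r s)^2\<close>.\<close>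
  ultimately have "4 * N ^ 4 + N\<^sup>2 * M\<^sup>2 + 4 * M ^ 4 = (3 * M * (r\<^sup>2 + s\<^sup>2))\<^sup>2"
    by algebra
  moreover have "N \<noteq> 0"
    using \<open>r \<noteq> s\<close> assms(1,2) by (auto simp: N_def power2_eq_iff)
  moreover have "even N"
    using odd by (simp add: N_def)
  ultimately show False
    using even M(1) by blast
qed

section \<open>Rational points\<close>

lemma rat_square_eq_of_intE:
  fixes x :: rat
  assumes "x\<^sup>2 = of_int n"
  obtains k where "n = k\<^sup>2"
proof -
  obtain c d where "quotient_of x = (c, d)"
    by force
  then have x: "x = of_int c / of_int d" and "d > 0"
    using quotient_of_div quotient_of_denom_pos by auto
  have "of_int (c\<^sup>2) = (of_int (d\<^sup>2 * n) :: rat)"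
    using assms \<open>d > 0\<close> unfolding x by (simp add: field_simps)
  then have cd: "c\<^sup>2 = d\<^sup>2 * n"
    by (simp only: of_int_eq_iff)
  then have "d dvd c"
    by (metis dvd_triv_left pos2 pow_divides_pow_iff)
  then obtain k where "c = d * k" ..
  with cd \<open>d > 0\<close> have "n = k\<^sup>2"
    by (simp add: power_mult_distrib)
  with that show thesis .
qed

text \<open>Clearing denominators makes \<open>(y v^2)^2\<close> an integer, hence an integer
  square. The form is positive because \<open>A (u^2 + v^2) >= 2 A |u v| > |B u v|\<close>, which in
  turn forces \<open>u v > 0\<close>.\<close>

lemma rational_point_quartic:
  fixes q y :: rat and A B :: int
  assumes "q \<noteq> 0" "y\<^sup>2 = q * (of_int A * q\<^sup>2 + of_int B * q + of_int A)"
    and "A > 0" "\<bar>B\<bar> \<le> A"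
  obtains u v k where "u > 0" "v > 0" "coprime u v" "q = of_int u / of_int v" "k > 0"
    "(u * v) * (A * u\<^sup>2 + B * (u * v) + A * v\<^sup>2) = k\<^sup>2" "A * u\<^sup>2 + B * (u * v) + A * v\<^sup>2 > 0"
proof -
  obtain u v where "quotient_of q = (u, v)"
    by force
  then have q: "q = of_int u / of_int v" and "v > 0" and "coprime u v"
    using quotient_of_div quotient_of_denom_pos quotient_of_coprime by auto
  have "u \<noteq> 0"
    using q \<open>q \<noteq> 0\<close> by auto
  have "(y * of_int v ^ 2)\<^sup>2 = y\<^sup>2 * of_int v ^ 4"
    by algebra
  also have "\<dots> = of_int ((u * v) * (A * u\<^sup>2 + B * (u * v) + A * v\<^sup>2))"
    unfolding assms(2) q using \<open>v > 0\<close>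
    by (simp add: field_simps power2_eq_square power4_eq_xxxx)
  finally obtain k where k: "(u * v) * (A * u\<^sup>2 + B * (u * v) + A * v\<^sup>2) = k\<^sup>2"
    by (rule rat_square_eq_of_intE)
  have "\<bar>B * (u * v)\<bar> \<le> A * \<bar>u * v\<bar>"
    unfolding abs_mult[of B] using assms(4) by (rule mult_right_mono) simp
  moreover have "2 * \<bar>u * v\<bar> \<le> u\<^sup>2 + v\<^sup>2"
    using sum_squares_ge_zero[of "u - v" "0::int"] sum_squares_ge_zero[of "u + v" "0::int"]
    by (simp add: power2_eq_square algebra_simps abs_if)
  then have "A * (2 * \<bar>u * v\<bar>) \<le> A * (u\<^sup>2 + v\<^sup>2)"
    using \<open>A > 0\<close> by (intro mult_left_mono) auto
  moreover have "A * \<bar>u * v\<bar> > 0"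
    using \<open>A > 0\<close> \<open>u \<noteq> 0\<close> \<open>v > 0\<close> by simp
  ultimately have Q: "A * u\<^sup>2 + B * (u * v) + A * v\<^sup>2 > 0"
    unfolding distrib_left by linarith
  have "(u * v) * (A * u\<^sup>2 + B * (u * v) + A * v\<^sup>2) \<ge> 0"
    unfolding k by simp
  then have "u * v \<ge> 0"
    using Q by (simp add: zero_le_mult_iff)
  then have "u > 0"
    using \<open>v > 0\<close> \<open>u \<noteq> 0\<close> by (simp add: zero_le_mult_iff)
  have "k \<noteq> 0"
    using k Q \<open>u > 0\<close> \<open>v > 0\<close> by auto
  then show thesis
    using that[of u v "\<bar>k\<bar>"] \<open>u > 0\<close> \<open>v > 0\<close> \<open>coprime u v\<close> q k Q by simp
qed

lemma coprime_mult_sum_squares: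
  fixes u v :: int
  assumes "coprime u v"
  shows "coprime (u * v) (u\<^sup>2 + v\<^sup>2)"
proof -
  have "gcd u (u * u + v\<^sup>2) = gcd u (v\<^sup>2)" "gcd v (v * v + u\<^sup>2) = gcd v (u\<^sup>2)"
    by (rule gcd_add_mult)+
  moreover have "coprime u (v\<^sup>2)" "coprime v (u\<^sup>2)"
    using assms by (simp_all add: coprime_commute)
  ultimately have "coprime u (u * u + v\<^sup>2)" "coprime v (v * v + u\<^sup>2)"
    by (simp_all only: coprime_iff_gcd_eq_1)
  then show ?thesis
    by (simp add: power2_eq_square add.commute)
qed

lemma rational_points_curve_24:
  fixes q y :: rat
  assumes "q \<noteq> 0" "y\<^sup>2 = q * (q\<^sup>2 - q + 1)"
  shows "q = 1"
proof -
  obtain u v k where uv: "u > 0" "v > 0" "coprime u v" "q = of_int u / of_int v" "k > 0"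
    "(u * v) * (u\<^sup>2 - u * v + v\<^sup>2) = k\<^sup>2" "u\<^sup>2 - u * v + v\<^sup>2 > 0"
    using rational_point_quartic[of q y 1 "- 1"] assms by auto
  \<comment> \<open>Subtracting \<open>u v\<close> does not change the gcd with \<open>u v\<close>,
    so the two factors of \<open>k^2\<close> are coprime; both are squares, and then so are
    \<open>u\<close> and \<open>v\<close>.\<close>
  have "gcd (u * v) (- 1 * (u * v) + (u\<^sup>2 + v\<^sup>2)) = gcd (u * v) (u\<^sup>2 + v\<^sup>2)"
    by (rule gcd_add_mult)
  moreover have "- 1 * (u * v) + (u\<^sup>2 + v\<^sup>2) = u\<^sup>2 - u * v + v\<^sup>2"
    by simp
  ultimately have "coprime (u * v) (u\<^sup>2 - u * v + v\<^sup>2)"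
    using coprime_mult_sum_squares[OF uv(3)] by (simp only: coprime_iff_gcd_eq_1)
  moreover have "u * v > 0"
    using uv by simp
  ultimately obtain j l where jl: "j > 0" "u * v = j\<^sup>2" "u\<^sup>2 - u * v + v\<^sup>2 = l\<^sup>2"
    using coprime_mult_eq_powerE[OF _ _ uv(7,5) pos2 uv(6)] by blast
  obtain r s where rs: "r > 0" "s > 0" "u = r\<^sup>2" "v = s\<^sup>2"
    using coprime_mult_eq_powerE[OF uv(3,1,2) jl(1) pos2 jl(2)] by blast
  have "r ^ 4 - r\<^sup>2 * s\<^sup>2 + s ^ 4 = l\<^sup>2"
    using jl(3) rs by simp
  moreover have "coprime r s"
    using uv rs by simp
  ultimately have "r = s"
    using quartic_24_trivial rs by blast
  then show ?thesis
    using uv rs by simp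
qed

lemma rational_points_curve_21:
  fixes q y :: rat
  assumes "q \<noteq> 0" "y\<^sup>2 = q * (4 * q\<^sup>2 + q + 4)"
  shows "q = 1"
proof -
  obtain u v k where uv: "u > 0" "v > 0" "coprime u v" "q = of_int u / of_int v" "k > 0"
    "(u * v) * (4 * u\<^sup>2 + u * v + 4 * v\<^sup>2) = k\<^sup>2" "4 * u\<^sup>2 + u * v + 4 * v\<^sup>2 > 0"
    using rational_point_quartic[of q y 4 1] assms by auto
  \<comment> \<open>Removing \<open>u v\<close> from the second factor leaves
    \<open>4 (u^2 + v^2)\<close>, so \<open>g\<close> divides 4.\<close>
  define g where "g = gcd (u * v) (4 * u\<^sup>2 + u * v + 4 * v\<^sup>2)"
  have "g dvd (4 * u\<^sup>2 + u * v + 4 * v\<^sup>2) - u * v" "g dvd u * v"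
    unfolding g_def by (meson dvd_diff gcd_dvd1 gcd_dvd2)+
  then have "g dvd 4 * (u * v)" "g dvd 4 * (u\<^sup>2 + v\<^sup>2)"
    by simp_all
  with coprime_mult_sum_squares[OF uv(3)] have "g dvd 4"
    by (rule dvd_if_dvd_mult_coprime)
  then have g: "gcd (u * v) (4 * u\<^sup>2 + u * v + 4 * v\<^sup>2) dvd 16"
    unfolding g_def by (rule dvd_trans) simp
  have uv_pos: "u * v > 0"
    using uv by simp
  show ?thesis
  proof (rule mult_eq_square_cases[OF uv_pos uv(7,5,6) g])
    fix j l
    assume jl: "u * v = 2 * j\<^sup>2" "4 * u\<^sup>2 + u * v + 4 * v\<^sup>2 = 2 * l\<^sup>2"
    \<comment> \<open>Impossible modulo 4: exactly one of the coprime \<open>u\<close>,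
      \<open>v\<close> is even, so \<open>u^2 + v^2\<close> is odd and \<open>l^2 - j^2\<close>
      would be 2.\<close>
    then have l: "l\<^sup>2 = j\<^sup>2 + 2 * (u\<^sup>2 + v\<^sup>2)"
      by simp
    have "even (u * v)"
      by (simp add: jl(1))
    then have "odd (u\<^sup>2 + v\<^sup>2)"
      using coprime_common_divisor[OF uv(3), of 2] by auto
    then obtain e where e: "u\<^sup>2 + v\<^sup>2 = 2 * e + 1"
      by (blast elim: oddE)
    have "even (l\<^sup>2 - j\<^sup>2)"
      unfolding l by simp
    then have "even (l + j)" "even (l - j)"
      by simp_all
    then have "2 * 2 dvd (l + j) * (l - j)"
      by (rule mult_dvd_mono)
    also have "(l + j) * (l - j) = 4 * e + 2"
      using l unfolding e by (simp add: power2_eq_square algebra_simps)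
    finally have False
      by presburger
    then show ?thesis ..
  next
    fix j l
    assume jl: "j > 0" "u * v = j\<^sup>2" "4 * u\<^sup>2 + u * v + 4 * v\<^sup>2 = l\<^sup>2"
    obtain r s where rs: "r > 0" "s > 0" "u = r\<^sup>2" "v = s\<^sup>2"
      using coprime_mult_eq_powerE[OF uv(3,1,2) jl(1) pos2 jl(2)] by blast
    have "4 * r ^ 4 + r\<^sup>2 * s\<^sup>2 + 4 * s ^ 4 = l\<^sup>2"
      using jl(3) rs by simp
    moreover have "coprime r s"
      using uv rs by simp
    ultimately have "r = s"
      using quartic_21_trivial rs by blast
    then show ?thesis
      using uv rs by simp
  qed
qed

section \<open>Quadratic factors\<close>

text \<open>Division by a monic quadratic: the two top coefficients determine the cofactor
  \<open>x^2 + r x + s\<close>, and the remainder, of degree at most 1, must vanish.\<close>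

lemma quadratic_dvd_quartic_iff:
  fixes p q c0 c1 c2 c3 :: "'a :: field"
  shows "[:q, p, 1:] dvd [:c0, c1, c2, c3, 1:] \<longleftrightarrow>
    (\<exists>r s. p + r = c3 \<and> q + s + p * r = c2 \<and> p * s + q * r = c1 \<and> q * s = c0)"
proof -
  define r s where "r = c3 - p" and "s = c2 - q - p * r"
  have "[:c0, c1, c2, c3, 1:] = [:q, p, 1:] * [:s, r, 1:] + [:c0 - q * s, c1 - p * s - q * r:]"
    by (simp add: r_def s_def algebra_simps)
  then have "[:q, p, 1:] dvd [:c0, c1, c2, c3, 1:] \<longleftrightarrow>
      [:q, p, 1:] dvd [:c0 - q * s, c1 - p * s - q * r:]"
    by (simp only: dvd_add_right_iff dvd_triv_left)
  also have "\<dots> \<longleftrightarrow> [:c0 - q * s, c1 - p * s - q * r:] = 0"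
  proof
    assume dvd: "[:q, p, 1:] dvd [:c0 - q * s, c1 - p * s - q * r:]"
    have "degree [:c0 - q * s, c1 - p * s - q * r:] \<le> 1" "degree [:q, p, 1:] = 2"
      by simp_all
    with dvd_imp_degree_le[OF dvd] show "[:c0 - q * s, c1 - p * s - q * r:] = 0"
      by linarith
  qed simp
  also have "\<dots> \<longleftrightarrow> (\<exists>r s. p + r = c3 \<and> q + s + p * r = c2 \<and> p * s + q * r = c1 \<and> q * s = c0)"
  proof
    assume "[:c0 - q * s, c1 - p * s - q * r:] = 0"
    then show "\<exists>r s. p + r = c3 \<and> q + s + p * r = c2 \<and> p * s + q * r = c1 \<and> q * s = c0"
      by (intro exI[of _ r] exI[of _ s]) (simp add: r_def s_def algebra_simps)
  next
    assume "\<exists>r s. p + r = c3 \<and> q + s + p * r = c2 \<and> p * s + q * r = c1 \<and> q * s = c0"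
    then obtain r' s' where *: "p + r' = c3" "q + s' + p * r' = c2" "p * s' + q * r' = c1" "q * s' = c0"
      by blast
    then have "r = r'" "s = s'"
      by (auto simp: r_def s_def)
    with * show "[:c0 - q * s, c1 - p * s - q * r:] = 0"
      by auto
  qed
  finally show ?thesis .
qed

text \<open>The cofactor must be \<open>x^2 - p x + 1/q\<close>. The linear coefficient says
  \<open>p (1 - q^2) = q\<close>, which excludes \<open>q^2 = 1\<close> and fixes \<open>p\<close>;
  the quadratic one then gives \<open>a = q + 1/q - p^2\<close>.\<close>

lemma quadratic_dvd_quartic_no_cubic_iff:
  fixes a p q :: "'a :: field"
  shows "[:q, p, 1:] dvd [:1, 1, a, 0, 1:] \<longleftrightarrow>
    q \<noteq> 0 \<and> q \<noteq> 1 \<and> q \<noteq> - 1 \<and>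
    a = (q ^ 6 - q ^ 4 - q ^ 3 - q\<^sup>2 + 1) / (q * (q - 1)\<^sup>2 * (q + 1)\<^sup>2) \<and>
    p = (- q) / (q\<^sup>2 - 1)" (is "_ \<longleftrightarrow> ?R")
proof
  assume "[:q, p, 1:] dvd [:1, 1, a, 0, 1:]"
  then obtain r s where rs: "p + r = 0" "q + s + p * r = a" "p * s + q * r = 1" "q * s = 1"
    unfolding quadratic_dvd_quartic_iff by blast
  have r: "r = - p"
    using rs(1) by (simp add: add_eq_0_iff)
  have q: "q \<noteq> 0"
    using rs(4) by auto
  have eq: "p * (1 - q\<^sup>2) = q"
    using rs(3,4) unfolding r by algebra
  then have "q\<^sup>2 \<noteq> 1"
    using q by auto
  then have q1: "q \<noteq> 1" "q \<noteq> - 1" "q\<^sup>2 - 1 \<noteq> 0"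
    by auto
  have p: "p = (- q) / (q\<^sup>2 - 1)"
    using eq q1(3) by (simp add: field_simps)
  have "a * q = q\<^sup>2 + 1 - p\<^sup>2 * q"
    unfolding rs(2)[symmetric] r using rs(4) by algebra
  moreover have "a * (q * (q - 1)\<^sup>2 * (q + 1)\<^sup>2) = (a * q) * (1 - q\<^sup>2)\<^sup>2"
    by algebra
  \<comment> \<open>After scaling by \<open>q (1 - q^2)^2\<close>, \<open>p\<close> enters only
    through \<open>p (1 - q^2)\<close>, which is \<open>q\<close>.\<close>
  ultimately have "a * (q * (q - 1)\<^sup>2 * (q + 1)\<^sup>2)
      = (q\<^sup>2 + 1) * (1 - q\<^sup>2)\<^sup>2 - q * (p * (1 - q\<^sup>2))\<^sup>2"
    by algebra
  also have "\<dots> = q ^ 6 - q ^ 4 - q ^ 3 - q\<^sup>2 + 1"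
    unfolding eq by algebra
  finally have "a * (q * (q - 1)\<^sup>2 * (q + 1)\<^sup>2) = q ^ 6 - q ^ 4 - q ^ 3 - q\<^sup>2 + 1" .
  then have "a = (q ^ 6 - q ^ 4 - q ^ 3 - q\<^sup>2 + 1) / (q * (q - 1)\<^sup>2 * (q + 1)\<^sup>2)"
    using q q1 by (simp add: eq_divide_eq add_eq_0_iff2)
  with p q q1 show ?R
    by blast
next
  assume R: ?R
  then have q: "q \<noteq> 0" "q - 1 \<noteq> 0" "q + 1 \<noteq> 0"
    by (auto simp: add_eq_0_iff2)
  have q2: "q\<^sup>2 - 1 = (q - 1) * (q + 1)"
    by algebra
  then have "q\<^sup>2 - 1 \<noteq> 0"
    using q by simp
  then have eq: "p * (1 - q\<^sup>2) = q"
    using R by (simp add: field_simps)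
  have "(q * (q - 1)\<^sup>2 * (q + 1)\<^sup>2) * (q + 1 / q - p\<^sup>2)
      = (q * q + q * (1 / q)) * (1 - q\<^sup>2)\<^sup>2 - q * (p * (1 - q\<^sup>2))\<^sup>2"
    by algebra
  also have "\<dots> = q ^ 6 - q ^ 4 - q ^ 3 - q\<^sup>2 + 1"
    unfolding eq times_divide_eq_right mult_1_right divide_self[OF q(1)] by algebra
  also have "\<dots> = (q * (q - 1)\<^sup>2 * (q + 1)\<^sup>2) * a"
    using R q by simp
  finally have "q + 1 / q - p\<^sup>2 = a"
    using q by simp
  moreover have "p * (1 / q) - q * p = 1"
    using eq q by (simp add: field_simps power2_eq_square)
  ultimately show "[:q, p, 1:] dvd [:1, 1, a, 0, 1:]"
    unfolding quadratic_dvd_quartic_iff using q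
    by (intro exI[of _ "- p"] exI[of _ "1 / q"]) (simp add: power2_eq_square)
qed

lemma quadratic_dvd_quartic_no_cubic_factorization:
  fixes a p q :: "'a :: field"
  assumes "[:q, p, 1:] dvd [:1, 1, a, 0, 1:]"
  shows "[:1, 1, a, 0, 1:] = [:q, - (q / (q\<^sup>2 - 1)), 1:] * [:1 / q, q / (q\<^sup>2 - 1), 1:]"
proof -
  obtain r s where rs: "p + r = 0" "q + s + p * r = a" "p * s + q * r = 1" "q * s = 1"
    using assms unfolding quadratic_dvd_quartic_iff by blast
  have "p = - (q / (q\<^sup>2 - 1))"
    using assms unfolding quadratic_dvd_quartic_no_cubic_iff by simp
  moreover have "r = - p"
    using rs(1) by (simp add: add_eq_0_iff)
  moreover have "s = 1 / q"
    using rs(4) by (metis mult_zero_left nonzero_mult_div_cancel_left zero_neq_one)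
  ultimately have "[:q, - (q / (q\<^sup>2 - 1)), 1:] * [:1 / q, q / (q\<^sup>2 - 1), 1:] = [:q, p, 1:] * [:s, r, 1:]"
    by simp
  also have "\<dots> = [:1, 1, a, 0, 1:]"
    using rs by (simp add: algebra_simps)
  finally show ?thesis ..
qed

lemma quadratic_dvd_quartic_no_square_iff:
  fixes a p q :: rat
  shows "[:q, p, 1:] dvd [:1, 1, 0, a, 1:] \<longleftrightarrow>
    (a, p, q) = (1, 2, 1) \<or> (a, p, q) = (1, - 1, 1)"
proof
  assume "[:q, p, 1:] dvd [:1, 1, 0, a, 1:]"
  then obtain r s where rs: "p + r = a" "q + s + p * r = 0" "p * s + q * r = 1" "q * s = 1"
    unfolding quadratic_dvd_quartic_iff by blast
  have "q \<noteq> 0"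
    using rs(4) by auto
  \<comment> \<open>By \<open>q s = 1\<close> the linear coefficient gives
    \<open>q^2 r = q - p\<close>. The quadratic one times \<open>q^2\<close> becomes
    \<open>p^2 - p q = q^3 + q\<close>, and completing the square gives the curve.\<close>
  moreover have "(2 * p - q)\<^sup>2 = q * (4 * q\<^sup>2 + q + 4)"
    using rs(2-4) by algebra
  ultimately have q: "q = 1"
    by (rule rational_points_curve_21)
  have s: "s = 1" and r: "r = 1 - p"
    using rs(3,4) q by auto
  have "(p - 2) * (p + 1) = 0"
    using rs(2) unfolding q s r by algebra
  then have "p = 2 \<or> p = - 1"
    by auto
  with q r rs(1) show "(a, p, q) = (1, 2, 1) \<or> (a, p, q) = (1, - 1, 1)"
    by auto
next
  assume "(a, p, q) = (1, 2, 1) \<or> (a, p, q) = (1, - 1, 1)"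
  then show "[:q, p, 1:] dvd [:1, 1, 0, a, 1:]"
    unfolding quadratic_dvd_quartic_iff by (intro exI[of _ "1 - p"] exI[of _ 1]) auto
qed

text \<open>The curve leaves only \<open>q = 1\<close>, so \<open>s = 1\<close> and the linear
  coefficient makes \<open>a = p + r\<close> zero. The excluded case is genuine:
  \<open>x^4 + x^2 + 1 = (x^2 + x + 1) (x^2 - x + 1)\<close>.\<close>

lemma no_quadratic_factor_no_linear:
  fixes a p q :: rat
  assumes "a \<noteq> 0"
  shows "\<not> [:q, p, 1:] dvd [:1, 0, 1, a, 1:]"
proof
  assume "[:q, p, 1:] dvd [:1, 0, 1, a, 1:]"
  then obtain r s where rs: "p + r = a" "q + s + p * r = 1" "p * s + q * r = 0" "q * s = 1"
    unfolding quadratic_dvd_quartic_iff by blast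
  have "q \<noteq> 0"
    using rs(4) by auto
  \<comment> \<open>Here \<open>q^2 r = - p\<close>, and the quadratic coefficient times
    \<open>q^2\<close> is the curve equation.\<close>
  moreover have "p\<^sup>2 = q * (q\<^sup>2 - q + 1)"
    using rs(2-4) by algebra
  ultimately have "q = 1"
    by (rule rational_points_curve_24)
  then show False
    using rs assms by simp
qed

theorem theorem2p3:
  fixes a p q :: rat
  assumes "a \<noteq> 0"
    and "p^2 + q^2 \<noteq> 0"
  shows
    "([:q, p, 1:] dvd [:1, 1, a, 0, 1:] \<longleftrightarrow>
        q \<noteq> 0 \<and> q \<noteq> 1 \<and> q \<noteq> -1 \<and>
        a = (q^6 - q^4 - q^3 - q^2 + 1) / (q * (q - 1)^2 * (q + 1)^2) \<and>
        p = (- q) / (q^2 - 1))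
     \<and> ([:q, p, 1:] dvd [:1, 1, a, 0, 1:] \<longrightarrow>
        [:1, 1, a, 0, 1:] = [:q, - (q / (q^2 - 1)), 1:] * [:1 / q, q / (q^2 - 1), 1:])
     \<and> ([:q, p, 1:] dvd [:1, 1, 0, a, 1:] \<longleftrightarrow>
        (a, p, q) = (1, 2, 1) \<or> (a, p, q) = (1, -1, 1))
     \<and> ([:q, p, 1:] dvd [:1, 1, 0, a, 1:] \<longrightarrow>
        [:1, 1, 0, a, 1:] = [:1, 1, 0, 1, 1:] \<and>
        ([:1, 1, 0, 1, 1:] :: rat poly) = [:1, -1, 1:] * [:1, 1:]^2)
     \<and> \<not> (\<exists>r s :: rat. [:s, r, 1:] dvd [:1, 0, 1, a, 1:])"
proof (intro conjI impI)
  assume "[:q, p, 1:] dvd [:1, 1, 0, a, 1:]"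
  then show "[:1, 1, 0, a, 1:] = [:1, 1, 0, 1, 1:]"
    unfolding quadratic_dvd_quartic_no_square_iff by auto
  show "([:1, 1, 0, 1, 1:] :: rat poly) = [:1, -1, 1:] * [:1, 1:]^2"
    by (simp add: power2_eq_square)
next
  show "\<not> (\<exists>r s :: rat. [:s, r, 1:] dvd [:1, 0, 1, a, 1:])"
    using no_quadratic_factor_no_linear[OF assms(1)] by blast
qed (fact quadratic_dvd_quartic_no_cubic_iff quadratic_dvd_quartic_no_square_iff
  | erule quadratic_dvd_quartic_no_cubic_factorization)+

end
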